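(* Let $\hat\rho>\bar\rho$, let $x^0\in\operatorname{dom}r$, and let $\{x^k\}_{k\ge1}$ be generated by the smoothed inexact proximal point method with parameter $\hat\rho$ described in the context, with constants $\lambda\in[0,1)$ and error terms $\zeta_k\ge0$. Let $x^\star$ be a minimizer of $\phi$. Then, for every $K\ge1$, $$\min_{1\le k\le K}\mathbb{E}\bigl[\|\nabla\phi_\eta^{\hat\rho}(x^k)\|^2\bigr]\le\frac{2\hat\rho^2}{\hat\rho-\bar\rho}\cdot\frac{(1+\lambda)\bigl[\phi(x^0)-\phi(x^\star)+R\eta\bigr]+\sum_{k=1}^K\mathbb{E}[\zeta_k]}{(1-\lambda)K}.$$
   Context: Problem. $\phi=f+r$ on $\mathbb{R}^d$, where $f(x)=\mathbb{E}_\xi[f(x,\xi)]$ with each $f(\cdot,\xi):\mathbb{R}^d\to\mathbb{R}$ weakly convex, and $r:\mathbb{R}^d\to(-\infty,+\infty]$ is proper, convex, lower semicontinuous and bounded below. Let $\mathcal{X}\supseteq\operatorname{dom}r$ be closed and convex. The smoothed problem is to minimize $\phi_\eta=f_\eta+r$, $f_\eta(x)=\mathbb{E}_\xi[f_\eta(x,\xi)]$, where $f_\eta$ is continuously differentiable and, for constants $\theta>0$, $\bar\rho>0$ and $R,B,L\ge0$ and every $\eta\in(0,\theta]$: $f_\eta$ is $\bar\rho$-weakly convex (i.e. $f_\eta+\frac{\bar\rho}2\|\cdot\|^2$ is convex); $f_\eta(x)\le f(x)\le f_\eta(x)+R\eta$ on $\mathcal{X}$; and $\|\nabla f_\eta(x)-\nabla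 f_\eta(y)\|\le L_\eta\|x-y\|$ on $\mathcal{X}$ with $L_\eta=B+L/\eta$. Moreover $\nabla f_\eta(x)=\mathbb{E}_\xi[\nabla f_\eta(x,\xi)]$ and $\mathbb{E}_\xi\|\nabla f_\eta(x,\xi)-\nabla f_\eta(x)\|^2\le\sigma^2$ for $x\in\operatorname{dom}r$. Fix $\eta\in(0,\theta]$; $\phi_\eta$ and $\phi$ are assumed to have minimizers. Moreau envelope: $\phi_\eta^{\hat\rho}(x)=\min_z\{\phi_\eta(z)+\frac{\hat\rho}{2}\|z-x\|^2\}$. Smoothed inexact proximal point method (SIPP). For $k=1,2,\dots$ let $\hat\phi_k(x):=\phi_\eta(x)+\frac{\hat\rho}{2}\|x-x^{k-1}\|^2$ and $\hat x^k:=\arg\min_x\hat\phi_k(x)$; compute a (possibly random) point $x^k$ with $$\mathbb{E}_k\bigl[\hat\phi_k(x^k)-\hat\phi_k(\hat x^k)\bigr]\le\lambda\bigl[\hat\phi_k(x^{k-1})-\hat\phi_k(\hat x^k)\bigr]+\zeta_k,$$ where $\lambda\in[0,1)$, $\zeta_k\in[0,\infty)$ is $\mathcal{F}_k$-measurable, $\mathcal{F}_k$ is the $\sigma$-algebra generated by $x^1,\dots,x^{k-1}$, and $\mathbb{E}_k[\cdot]=\mathbb{E}[\cdot\mid\mathcal{F}_k]$. *)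

theory Defs
  imports "HOL-Probability.Probability"
begin

subsection \<open>Convex analysis\<close>

definition weakly_convex :: "real \<Rightarrow> ('a::euclidean_space \<Rightarrow> real) \<Rightarrow> bool" where
  "weakly_convex \<rho> f \<longleftrightarrow> convex_on UNIV (\<lambda>x. f x + \<rho> / 2 * (norm x)\<^sup>2)"

text \<open>The next three notions concern functions into \<open>(-\<infinity>, \<infinity>]\<close>, represented as \<^typ>\<open>ereal\<close>-valued
  functions that do not take the value \<open>-\<infinity>\<close>.\<close>

definition effective_domain :: "('a \<Rightarrow> ereal) \<Rightarrow> 'a set" where
  "effective_domain r = {x. r x < \<infinity>}"

text \<open>For \<open>t = 0\<close> or \<open>t = 1\<close> the inequality is trivial because \<open>0 * \<infinity> = 0\<close> in \<^typ>\<open>ereal\<close>.\<close>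

definition convex_ereal :: "('a::euclidean_space \<Rightarrow> ereal) \<Rightarrow> bool" where
  "convex_ereal r \<longleftrightarrow> (\<forall>x y. \<forall>t\<in>{0..1}.
     r (t *\<^sub>R x + (1 - t) *\<^sub>R y) \<le> ereal t * r x + ereal (1 - t) * r y)"

definition lower_semicontinuous :: "('a::euclidean_space \<Rightarrow> ereal) \<Rightarrow> bool" where
  "lower_semicontinuous r \<longleftrightarrow> (\<forall>x. r x \<le> Liminf (at x) r)"

text \<open>Meaningful only where \<open>f\<close> is differentiable.\<close>

definition grad :: "('a::euclidean_space \<Rightarrow> real) \<Rightarrow> 'a \<Rightarrow> 'a" where
  "grad f x = (THE D. GDERIV f x :> D)"

lemma grad_eq: "grad f x = D" if "GDERIV f x :> D"
  unfolding grad_def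
proof (rule the_equality)
  show "GDERIV f x :> D" by (rule that)
next
  fix D' assume "GDERIV f x :> D'"
  then have "(\<lambda>h. inner h D') = (\<lambda>h. inner h D)"
    using that unfolding gderiv_def by (rule has_derivative_unique)
  then show "D' = D" by (metis inner_commute vector_eq_rdot)
qed

subsection \<open>Composite objective, proximal subproblem, Moreau envelope\<close>

definition composite :: "('a \<Rightarrow> real) \<Rightarrow> ('a \<Rightarrow> ereal) \<Rightarrow> 'a \<Rightarrow> ereal" where
  "composite f r x = ereal (f x) + r x"

definition prox_objective ::
    "('a::euclidean_space \<Rightarrow> ereal) \<Rightarrow> real \<Rightarrow> 'a \<Rightarrow> 'a \<Rightarrow> ereal" where
  "prox_objective \<phi> \<rho> c x = \<phi> x + ereal (\<rho> / 2 * (norm (x - c))\<^sup>2)"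

text \<open>The minimizer is unique in the strongly convex setting in which this is used.\<close>

definition prox_point :: "('a::euclidean_space \<Rightarrow> ereal) \<Rightarrow> real \<Rightarrow> 'a \<Rightarrow> 'a" where
  "prox_point \<phi> \<rho> c = (ARG_MIN (prox_objective \<phi> \<rho> c) x. True)"

text \<open>The infimum is attained and finite in the setting in which this is used, so the conversion to
  \<^typ>\<open>real\<close>, needed to take gradients, loses nothing.\<close>

definition moreau_envelope :: "('a::euclidean_space \<Rightarrow> ereal) \<Rightarrow> real \<Rightarrow> 'a \<Rightarrow> real" where
  "moreau_envelope \<phi> \<rho> x = real_of_ereal (INF z. prox_objective \<phi> \<rho> x z)"

subsection \<open>Smoothed inexact proximal point method\<close>

text \<open>The \<open>\<sigma>\<close>-algebra generated by \<open>x 1, \<dots>, x (k - 1)\<close>; it is trivial for \<open>k = 1\<close>.\<close>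

definition history :: "'w measure \<Rightarrow> (nat \<Rightarrow> 'w \<Rightarrow> 'a::euclidean_space) \<Rightarrow> nat \<Rightarrow> 'w measure" where
  "history M x k =
     sigma (space M) {x i -` A \<inter> space M | i A. i \<in> {1..<k} \<and> A \<in> sets borel}"

text \<open>The iterates \<open>x k\<close> need not lie in the domain of \<open>\<phi>\<close>, so the gap inside the conditional
  expectation takes values in \<open>[0, \<infinity>]\<close> (it is nonnegative because the proximal point is a minimizer,
  so \<^const>\<open>e2ennreal\<close> does not truncate); no integrability is presupposed.\<close>

definition sipp_sequence ::
    "'w measure \<Rightarrow> ('a::euclidean_space \<Rightarrow> ereal) \<Rightarrow> real \<Rightarrow> real \<Rightarrow> (nat \<Rightarrow> 'w \<Rightarrow> real) \<Rightarrow> 'a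
       \<Rightarrow> (nat \<Rightarrow> 'w \<Rightarrow> 'a) \<Rightarrow> bool" where
  "sipp_sequence M \<phi> \<rho> lam \<zeta> x0 x \<longleftrightarrow>
     (\<forall>\<omega>\<in>space M. x 0 \<omega> = x0) \<and>
     (\<forall>k\<ge>1. x k \<in> borel_measurable M) \<and>
     (\<forall>k\<ge>1. \<zeta> k \<in> borel_measurable (history M x k)) \<and>
     (\<forall>k\<ge>1. \<forall>\<omega>\<in>space M. 0 \<le> \<zeta> k \<omega>) \<and>
     (\<forall>k\<ge>1.
        let \<phi>hat = (\<lambda>\<omega>. prox_objective \<phi> \<rho> (x (k - 1) \<omega>));
            xhat = (\<lambda>\<omega>. prox_point \<phi> \<rho> (x (k - 1) \<omega>))
        in AE \<omega> in M.
             enn2ereal (nn_cond_exp M (history M x k)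
               (\<lambda>\<omega>. e2ennreal (\<phi>hat \<omega> (x k \<omega>) - \<phi>hat \<omega> (xhat \<omega>))) \<omega>)
             \<le> ereal lam * (\<phi>hat \<omega> (x (k - 1) \<omega>) - \<phi>hat \<omega> (xhat \<omega>)) + ereal (\<zeta> k \<omega>))"

end

theory Submission
  imports Defs
begin

text \<open>Let \<open>D\<^sub>k = \<phi> (x k) - env (x k) \<ge> 0\<close> be the gap between the (smoothed) objective and its Moreau
  envelope, and let \<open>\<mu> = \<rho>hat - \<rho>bar\<close>. The proximal objective is \<open>\<mu>\<close>-strongly convex and the gradient
  of the envelope at \<open>c\<close> is \<open>\<rho>hat (c - prox c)\<close>, so its squared norm at \<open>x k\<close> is at most
  \<open>2 \<rho>hat\<^sup>2 / \<mu> * D\<^sub>k\<close>. The inexactness condition gives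
  \<open>E \<phi> (x (k + 1)) + (1 - lam) E D\<^sub>k \<le> E \<phi> (x k) + E \<zeta> (k + 1)\<close>, which telescopes. All expectations
  are taken in \<open>[0, \<infinity>]\<close>, after subtracting the minimum \<open>m\<close> of \<open>\<phi>\<close>, so that no integrability is
  needed.\<close>

section \<open>Lower semicontinuity and existence of minimizers\<close>

lemma lower_semicontinuous_iff_open:
  "lower_semicontinuous g \<longleftrightarrow> (\<forall>c. open {z. c < g z})"
proof
  assume lsc: "lower_semicontinuous g"
  show "\<forall>c. open {z. c < g z}"
  proof
    fix c
    have "\<forall>\<^sub>F w in nhds z. c < g w" if "c < g z" for z
    proof -
      \<comment> \<open>The filter \<open>at z\<close> omits \<open>z\<close> itself; the assumed
        inequality at \<open>z\<close> completes it to a full neighbourhood.\<close>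
      have "c < Liminf (at z) g"
        using that lsc unfolding lower_semicontinuous_def by (meson less_le_trans)
      then show ?thesis
        using that by (auto dest: less_LiminfD simp: eventually_nhds_conv_at)
    qed
    then show "open {z. c < g z}"
      by (subst open_subopen) (simp add: eventually_nhds subset_iff, blast)
  qed
next
  assume "\<forall>c. open {z. c < g z}"
  then have "\<forall>\<^sub>F w in at z. c < g w" if "c < g z" for c z
    using that eventually_at_topological by blast
  then show "lower_semicontinuous g"
    unfolding lower_semicontinuous_def le_Liminf_iff by blast
qed

text \<open>Strictness leaves room for a real \<open>a\<close> with
  \<open>c - h z < a < g z\<close>. Near \<open>z\<close>, \<open>a < g w\<close> holds by openness
  and \<open>c < a + h w\<close> by continuity.\<close>

lemma lower_semicontinuous_add_continuous:
  assumes g: "lower_semicontinuous g" and h: "continuous_on UNIV h"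
  shows "lower_semicontinuous (\<lambda>z. g z + ereal (h z))"
  unfolding lower_semicontinuous_def le_Liminf_iff
proof (intro allI impI)
  fix z c assume "c < g z + ereal (h z)"
  then have "c - ereal (h z) < g z"
    by (simp add: ereal_minus_less)
  then obtain a where a: "c - ereal (h z) < ereal a" "ereal a < g z"
    using ereal_dense2 by blast
  have "open {w. ereal a < g w}"
    using g by (simp add: lower_semicontinuous_iff_open)
  then have 1: "\<forall>\<^sub>F w in at z. ereal a < g w"
    using a(2) eventually_at_topological by blast
  have "(h \<longlongrightarrow> h z) (at z)"
    using h by (simp add: continuous_on)
  then have *: "((\<lambda>w. a + h w) \<longlongrightarrow> a + h z) (at z)"
    by (intro tendsto_intros)
  have "c < ereal (a + h z)"
    using a(1) by (cases c) auto
  then have 2: "\<forall>\<^sub>F w in at z. c < ereal (a + h w)"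
    using order_tendstoD(1)[OF *] by (cases c) auto
  show "\<forall>\<^sub>F w in at z. c < g w + ereal (h w)"
    using 1 2
  proof eventually_elim
    case (elim w)
    have "ereal (a + h w) \<le> g w + ereal (h w)"
      using add_mono[OF less_imp_le[OF elim(1)] order_refl[of "ereal (h w)"]] by simp
    with elim(2) show ?case by (rule less_le_trans)
  qed
qed

lemma lower_semicontinuous_borel_measurable:
  "lower_semicontinuous g \<Longrightarrow> g \<in> borel_measurable borel"
  by (rule borel_measurableI_greater) (simp add: lower_semicontinuous_iff_open)

text \<open>Direct method: the sublevel sets \<open>S n\<close> at levels decreasing to the infimum
  are closed, bounded by the quadratic minorant, nonempty and nested. A point common to all of them
  attains the infimum.\<close>

lemma lower_semicontinuous_coercive_attains_inf:
  fixes g :: "'a::euclidean_space \<Rightarrow> ereal"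
  assumes lsc: "lower_semicontinuous g"
    and bound: "\<And>z. ereal (m + a * (norm (z - c))\<^sup>2) \<le> g z" and "a > 0"
    and fin: "g z0 < \<infinity>"
  shows "\<exists>p. \<forall>z. g p \<le> g z"
proof -
  define i where "i = (INF z. g z)"
  have "ereal m \<le> i"
    unfolding i_def
  proof (rule INF_greatest)
    fix z
    have "ereal m \<le> ereal (m + a * (norm (z - c))\<^sup>2)" using \<open>a > 0\<close> by simp
    also note bound
    finally show "ereal m \<le> g z" .
  qed
  moreover have "i \<le> g z0" unfolding i_def by (rule INF_lower) simp
  ultimately obtain i' where i': "i = ereal i'"
    using fin by (cases i) auto
  define S where "S n = {z. g z \<le> ereal (i' + 1 / real (Suc n))}" for n
  have "closed (S n)" for n
    using lsc unfolding S_def lower_semicontinuous_iff_open closed_def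
    by (simp add: Collect_neg_eq[symmetric] not_le)
  \<comment> \<open>All levels are at most \<open>i' + 1\<close>, so one radius serves every
    \<open>n\<close>; it is where the minorant reaches that level.\<close>
  moreover have "S n \<subseteq> cball c (sqrt ((i' + 1 - m) / a))" for n
  proof
    fix z assume "z \<in> S n"
    have "g z \<le> ereal (i' + 1 / real (Suc n))" using \<open>z \<in> S n\<close> unfolding S_def by simp
    with bound have "ereal (m + a * (norm (z - c))\<^sup>2) \<le> ereal (i' + 1 / real (Suc n))"
      by (rule order_trans)
    moreover have "1 / real (Suc n) \<le> 1" by simp
    ultimately have "m + a * (norm (z - c))\<^sup>2 \<le> i' + 1"
      unfolding ereal_less_eq by linarith
    then have "(norm (z - c))\<^sup>2 \<le> (i' + 1 - m) / a"
      using \<open>a > 0\<close> by (simp add: field_simps)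
    then show "z \<in> cball c (sqrt ((i' + 1 - m) / a))"
      by (simp add: dist_norm norm_minus_commute real_le_rsqrt)
  qed
  ultimately have comp: "compact (S n)" for n
    by (meson bounded_cball bounded_subset compact_eq_bounded_closed)
  have ne: "S n \<noteq> {}" for n
  proof -
    have "i < ereal (i' + 1 / real (Suc n))" using i' by simp
    then obtain z where "g z < ereal (i' + 1 / real (Suc n))"
      unfolding i_def INF_less_iff by auto
    then show ?thesis unfolding S_def by (auto intro: less_imp_le)
  qed
  have mono: "S n \<subseteq> S k" if "k \<le> n" for k n
  proof -
    have "1 / real (Suc n) \<le> 1 / real (Suc k)" using that by (simp add: frac_le)
    then have "ereal (i' + 1 / real (Suc n)) \<le> ereal (i' + 1 / real (Suc k))" by simp
    then show ?thesis unfolding S_def by (auto intro: order_trans)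
  qed
  obtain p where p: "\<And>n. p \<in> S n"
    using compact_nest[of S, OF comp ne mono] by auto
  have "g p \<le> i"
  proof (rule ereal_le_epsilon2)
    fix e :: real assume "e > 0"
    then obtain n where "inverse (real (Suc n)) < e" using reals_Archimedean by blast
    then have "ereal (i' + 1 / real (Suc n)) \<le> i + ereal e"
      using i' by (simp add: inverse_eq_divide)
    then show "g p \<le> i + ereal e" using p[of n] unfolding S_def by auto
  qed
  then show ?thesis unfolding i_def by (meson INF_lower UNIV_I order_trans)
qed

section \<open>Proximal map and gradient of the Moreau envelope\<close>

lemma norm_sq_convex_combination:
  fixes u v :: "'a::real_inner"
  shows "(norm (t *\<^sub>R u + (1 - t) *\<^sub>R v))\<^sup>2
    = t * (norm u)\<^sup>2 + (1 - t) * (norm v)\<^sup>2 - t * (1 - t) * (norm (u - v))\<^sup>2"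
  unfolding power2_norm_eq_inner
  by (simp add: inner_add_left inner_add_right inner_diff_left inner_diff_right
      inner_commute algebra_simps)

text \<open>Weak convexity is stated through \<open>convex_ereal\<close> because \<phi> may be
  infinite. The bound \<open>m\<close> makes the proximal objective coercive and is the level
  subtracted from \<phi> before integration.\<close>

locale prox_problem =
  fixes \<phi> :: "'a::euclidean_space \<Rightarrow> ereal" and \<rho>bar \<rho> m :: real
  assumes wconv: "convex_ereal (\<lambda>z. \<phi> z + ereal (\<rho>bar / 2 * (norm z)\<^sup>2))"
    and lsc: "lower_semicontinuous \<phi>"
    and lb: "ereal m \<le> \<phi> z"
    and proper: "\<exists>z. \<phi> z < \<infinity>"
    and pos: "0 < \<rho>" and less: "\<rho>bar < \<rho>"
begin

abbreviation "prox \<equiv> prox_point \<phi> \<rho>"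
abbreviation "env \<equiv> moreau_envelope \<phi> \<rho>"

text \<open>\<open>prox_point\<close> is defined by choice, so its minimality follows from existence
  of some minimizer; \<open>m\<close> plus the proximal term is the coercive minorant.\<close>

lemma prox_minimizes: "prox_objective \<phi> \<rho> c (prox c) \<le> prox_objective \<phi> \<rho> c z"
proof -
  obtain z0 where z0: "\<phi> z0 < \<infinity>" using proper by blast
  have "\<exists>p. \<forall>z. prox_objective \<phi> \<rho> c p \<le> prox_objective \<phi> \<rho> c z"
  proof (rule lower_semicontinuous_coercive_attains_inf)
    show "lower_semicontinuous (prox_objective \<phi> \<rho> c)"
      unfolding prox_objective_def
      by (rule lower_semicontinuous_add_continuous[OF lsc]) (intro continuous_intros)
    show "ereal (m + \<rho> / 2 * (norm (z - c))\<^sup>2) \<le> prox_objective \<phi> \<rho> c z" for z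
      using add_right_mono[OF lb[of z], of "ereal (\<rho> / 2 * (norm (z - c))\<^sup>2)"]
      unfolding prox_objective_def by simp
    show "prox_objective \<phi> \<rho> c z0 < \<infinity>"
      using z0 unfolding prox_objective_def by auto
  qed (use pos in simp)
  then have "\<exists>p. is_arg_min (prox_objective \<phi> \<rho> c) (\<lambda>_. True) p"
    by (auto simp: is_arg_min_def not_less)
  then have "is_arg_min (prox_objective \<phi> \<rho> c) (\<lambda>_. True) (prox c)"
    unfolding prox_point_def arg_min_def by (rule someI_ex)
  then show ?thesis by (auto simp: is_arg_min_def not_less)
qed

text \<open>The minimal value is finite, being bounded below through \<open>m\<close> and above
  through a point where \<phi> is finite, so \<open>real_of_ereal\<close> is exact.\<close>

lemma env_eq: "ereal (env c) = prox_objective \<phi> \<rho> c (prox c)"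
proof -
  have inf: "(INF z. prox_objective \<phi> \<rho> c z) = prox_objective \<phi> \<rho> c (prox c)"
    by (intro antisym INF_lower INF_greatest prox_minimizes) simp
  obtain z0 where "\<phi> z0 < \<infinity>" using proper by blast
  then have "prox_objective \<phi> \<rho> c z0 < \<infinity>" unfolding prox_objective_def by auto
  then have "prox_objective \<phi> \<rho> c (prox c) < \<infinity>"
    using prox_minimizes[of c z0] by (rule le_less_trans[rotated])
  moreover have "- \<infinity> < prox_objective \<phi> \<rho> c (prox c)"
    using lb[of "prox c"] unfolding prox_objective_def by (cases "\<phi> (prox c)") auto
  ultimately show ?thesis
    unfolding moreau_envelope_def inf
    by (cases "prox_objective \<phi> \<rho> c (prox c)") auto
qed

lemma phi_prox: "\<phi> (prox c) = ereal (env c - \<rho> / 2 * (norm (prox c - c))\<^sup>2)"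
  using env_eq[of c] unfolding prox_objective_def by (cases "\<phi> (prox c)") auto

lemma env_le_prox_objective: "ereal (env c) \<le> prox_objective \<phi> \<rho> c z"
  by (simp add: env_eq prox_minimizes)

lemma env_le: "ereal (env c) \<le> \<phi> c"
  using env_le_prox_objective[of c c] by (simp add: prox_objective_def)

lemma lb_env: "m \<le> env c"
proof -
  have "m \<le> env c - \<rho> / 2 * (norm (prox c - c))\<^sup>2"
    using lb[of "prox c"] unfolding phi_prox by simp
  then show ?thesis using pos by (smt (verit) mult_nonneg_nonneg zero_le_power2 divide_nonneg_nonneg)
qed

text \<open>The proximal objective is strongly convex with modulus
  \<open>\<rho> - \<rho>bar\<close>. Its minimality at \<open>p\<close> is tested at points
  \<open>w\<close> between \<open>p\<close> and \<open>z\<close>; after division by the weight of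
  \<open>z\<close>, that weight tends to 0.\<close>

lemma quadratic_growth:
  assumes z: "\<phi> z = ereal v"
  shows "env c + (\<rho> - \<rho>bar) / 2 * (norm (z - prox c))\<^sup>2 \<le> v + \<rho> / 2 * (norm (z - c))\<^sup>2"
proof -
  define p where "p = prox c"
  define b where "b = env c - \<rho> / 2 * (norm (p - c))\<^sup>2"
  define N where "N = (\<rho> - \<rho>bar) / 2 * (norm (z - p))\<^sup>2"
  have p: "\<phi> p = ereal b" unfolding p_def b_def by (rule phi_prox)
  have "s * N \<le> v + \<rho> / 2 * (norm (z - c))\<^sup>2 - env c" if s: "0 < s" "s < 1" for s
  proof -
    \<comment> \<open>The weight of \<open>z\<close> is \<open>t\<close>, and \<open>s\<close> is
      the factor left before \<open>N\<close> after division by \<open>t\<close>; thus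
      \<open>t\<close> tending to 0 becomes \<open>s\<close> tending to 1.\<close>
    define t where "t = 1 - s"
    have t: "0 < t" "t < 1" using s unfolding t_def by auto
    define w where "w = t *\<^sub>R z + (1 - t) *\<^sub>R p"
    have "\<phi> w + ereal (\<rho>bar / 2 * (norm w)\<^sup>2)
        \<le> ereal t * (\<phi> z + ereal (\<rho>bar / 2 * (norm z)\<^sup>2))
          + ereal (1 - t) * (\<phi> p + ereal (\<rho>bar / 2 * (norm p)\<^sup>2))"
      using wconv t unfolding convex_ereal_def w_def by auto
    then obtain u where u: "\<phi> w = ereal u"
      and conv: "u + \<rho>bar / 2 * (norm w)\<^sup>2
        \<le> t * (v + \<rho>bar / 2 * (norm z)\<^sup>2) + (1 - t) * (b + \<rho>bar / 2 * (norm p)\<^sup>2)"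
      using lb[of w] z p by (cases "\<phi> w") auto
    have min: "env c \<le> u + \<rho> / 2 * (norm (w - c))\<^sup>2"
      using env_le_prox_objective[of c w] unfolding prox_objective_def u by simp
    have w1: "(norm w)\<^sup>2 = t * (norm z)\<^sup>2 + (1 - t) * (norm p)\<^sup>2 - t * (1 - t) * (norm (z - p))\<^sup>2"
      unfolding w_def by (rule norm_sq_convex_combination)
    have "w - c = t *\<^sub>R (z - c) + (1 - t) *\<^sub>R (p - c)"
      unfolding w_def by (simp add: algebra_simps)
    then have w2: "(norm (w - c))\<^sup>2
        = t * (norm (z - c))\<^sup>2 + (1 - t) * (norm (p - c))\<^sup>2 - t * (1 - t) * (norm (z - p))\<^sup>2"
      by (simp add: norm_sq_convex_combination)
    have e: "env c = b + \<rho> / 2 * (norm (p - c))\<^sup>2" unfolding b_def by simp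
    \<comment> \<open>The \<open>norm (z - p)\<close> terms of \<open>w1\<close> and
      \<open>w2\<close> enter with opposite signs and combine to \<open>t * (1 - t) * N\<close>; the
      other \<open>\<rho>bar\<close> terms cancel.\<close>
    have "t * ((1 - t) * N) \<le> t * (v + \<rho> / 2 * (norm (z - c))\<^sup>2 - env c)"
      using conv min unfolding w1 w2 N_def e by (simp add: algebra_simps add_divide_distrib diff_divide_distrib)
    then show ?thesis using t unfolding t_def by simp
  qed
  then have "N \<le> v + \<rho> / 2 * (norm (z - c))\<^sup>2 - env c"
    by (rule field_le_mult_one_interval)
  then show ?thesis unfolding N_def p_def by simp
qed

text \<open>Quadratic growth is applied at each centre with the other proximal point as test point.
  In the sum the envelope values cancel and the four squared distances collapse to an inner
  product.\<close>

lemma prox_lipschitz: "(\<rho> - \<rho>bar) * norm (prox y - prox c) \<le> \<rho> * norm (y - c)"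
proof -
  let ?p = "prox c" and ?q = "prox y"
  have 1: "env c + (\<rho> - \<rho>bar) / 2 * (norm (?q - ?p))\<^sup>2
      \<le> env y - \<rho> / 2 * (norm (?q - y))\<^sup>2 + \<rho> / 2 * (norm (?q - c))\<^sup>2"
    by (rule quadratic_growth[OF phi_prox])
  have 2: "env y + (\<rho> - \<rho>bar) / 2 * (norm (?q - ?p))\<^sup>2
      \<le> env c - \<rho> / 2 * (norm (?p - c))\<^sup>2 + \<rho> / 2 * (norm (?p - y))\<^sup>2"
    using quadratic_growth[OF phi_prox, of y c] by (simp add: norm_minus_commute)
  have "(norm (?q - c))\<^sup>2 - (norm (?q - y))\<^sup>2 + (norm (?p - y))\<^sup>2 - (norm (?p - c))\<^sup>2
      = 2 * ((?q - ?p) \<bullet> (y - c))"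
    unfolding power2_norm_eq_inner
    by (simp add: inner_diff_left inner_diff_right inner_commute algebra_simps)
  then have "\<rho> / 2 * (norm (?q - c))\<^sup>2 - \<rho> / 2 * (norm (?q - y))\<^sup>2
      + \<rho> / 2 * (norm (?p - y))\<^sup>2 - \<rho> / 2 * (norm (?p - c))\<^sup>2
      = \<rho> / 2 * (2 * ((?q - ?p) \<bullet> (y - c)))"
    by (metis (no_types, opaque_lifting) distrib_left right_diff_distrib)
  then have "(\<rho> - \<rho>bar) * (norm (?q - ?p))\<^sup>2 \<le> \<rho> * ((?q - ?p) \<bullet> (y - c))"
    using 1 2 by simp
  also have "\<dots> \<le> \<rho> * (norm (?q - ?p) * norm (y - c))"
    using pos norm_cauchy_schwarz by (simp add: mult_left_mono)
  finally have "norm (?q - ?p) * ((\<rho> - \<rho>bar) * norm (?q - ?p)) \<le> norm (?q - ?p) * (\<rho> * norm (y - c))"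
    by (simp add: power2_eq_square algebra_simps)
  then show ?thesis
    using pos by (cases "?q = ?p") auto
qed

text \<open>\<open>prox c\<close> serves as trial point for the problem centred at
  \<open>y\<close>.\<close>

lemma env_diff_le:
  "env y - env c \<le> \<rho> * ((y - c) \<bullet> (c - prox c)) + \<rho> / 2 * (norm (y - c))\<^sup>2"
proof -
  have "env y \<le> env c - \<rho> / 2 * (norm (prox c - c))\<^sup>2 + \<rho> / 2 * (norm (prox c - y))\<^sup>2"
    using env_le_prox_objective[of y "prox c"] unfolding prox_objective_def phi_prox by simp
  moreover have "(norm (prox c - y))\<^sup>2
      = (norm (prox c - c))\<^sup>2 + 2 * ((y - c) \<bullet> (c - prox c)) + (norm (y - c))\<^sup>2"
    unfolding power2_norm_eq_inner
    by (simp add: inner_diff_left inner_diff_right inner_commute algebra_simps)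
  ultimately show ?thesis by (simp add: algebra_simps add_divide_distrib)
qed

text \<open>The upper half is \<open>env_diff_le\<close>. Exchanging \<open>y\<close> and
  \<open>c\<close> gives the lower half with the linear term taken at \<open>y\<close>; moving it to
  \<open>c\<close> costs an inner product with \<open>prox y - prox c\<close>, which the Lipschitz
  bound makes quadratic.\<close>

lemma env_first_order:
  "\<bar>env y - env c - (y - c) \<bullet> (\<rho> *\<^sub>R (c - prox c))\<bar>
    \<le> (\<rho> / 2 + \<rho>\<^sup>2 / (\<rho> - \<rho>bar)) * (norm (y - c))\<^sup>2"
proof -
  let ?D = "prox y - prox c"
  have "norm ?D \<le> \<rho> / (\<rho> - \<rho>bar) * norm (y - c)"
    using prox_lipschitz[of y c] less by (simp add: field_simps)
  then have "norm (y - c) * norm ?D \<le> norm (y - c) * (\<rho> / (\<rho> - \<rho>bar) * norm (y - c))"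
    by (rule mult_left_mono) simp
  then have "(y - c) \<bullet> ?D \<le> \<rho> / (\<rho> - \<rho>bar) * (norm (y - c))\<^sup>2"
    using norm_cauchy_schwarz[of "y - c" ?D] by (simp add: power2_eq_square mult_ac)
  then have "\<rho> * ((y - c) \<bullet> ?D) \<le> \<rho> * (\<rho> / (\<rho> - \<rho>bar) * (norm (y - c))\<^sup>2)"
    by (rule mult_left_mono) (use pos in simp)
  then have D: "\<rho> * ((y - c) \<bullet> ?D) \<le> \<rho>\<^sup>2 / (\<rho> - \<rho>bar) * (norm (y - c))\<^sup>2"
    by (simp add: power2_eq_square)
  have "env c - env y \<le> \<rho> * ((c - y) \<bullet> (y - prox y)) + \<rho> / 2 * (norm (y - c))\<^sup>2"
    using env_diff_le[of c y] by (simp add: norm_minus_commute)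
  also have "(c - y) \<bullet> (y - prox y)
      = (y - c) \<bullet> ?D - (norm (y - c))\<^sup>2 - (y - c) \<bullet> (c - prox c)"
    unfolding power2_norm_eq_inner
    by (simp add: inner_diff_left inner_diff_right inner_commute algebra_simps)
  finally have "env c - env y \<le> \<rho> * ((y - c) \<bullet> ?D) - \<rho> * ((y - c) \<bullet> (c - prox c))
      - \<rho> / 2 * (norm (y - c))\<^sup>2"
    by (simp add: right_diff_distrib)
  moreover have "0 \<le> \<rho> / 2 * (norm (y - c))\<^sup>2" "0 \<le> \<rho>\<^sup>2 / (\<rho> - \<rho>bar) * (norm (y - c))\<^sup>2"
    using pos less by auto
  ultimately show ?thesis
    using D env_diff_le[of y c] unfolding inner_scaleR_right distrib_right abs_le_iff
    by linarith
qed

text \<open>The remainder in \<open>env_first_order\<close> is quadratic, hence vanishes after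
  division by the distance.\<close>

lemma GDERIV_env: "GDERIV env c :> \<rho> *\<^sub>R (c - prox c)"
  unfolding gderiv_def has_derivative_iff_norm
proof (intro conjI)
  show "bounded_linear (\<lambda>h. h \<bullet> (\<rho> *\<^sub>R (c - prox c)))"
    by (rule bounded_linear_inner_left)
  let ?C = "\<rho> / 2 + \<rho>\<^sup>2 / (\<rho> - \<rho>bar)"
  have lim: "((\<lambda>y. ?C * norm (y - c)) \<longlongrightarrow> 0) (at c)"
    by (rule tendsto_eq_rhs[of _ "?C * norm (c - c)"]) (intro tendsto_intros, simp)
  have bd: "norm (env y - env c - (y - c) \<bullet> (\<rho> *\<^sub>R (c - prox c))) / norm (y - c) \<le> ?C * norm (y - c)"
    if "y \<noteq> c" for y
    using env_first_order[of y c] that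
    by (simp add: divide_le_eq power2_eq_square mult.assoc)
  show "((\<lambda>y. norm (env y - env c - (y - c) \<bullet> (\<rho> *\<^sub>R (c - prox c))) / norm (y - c)) \<longlongrightarrow> 0) (at c)"
    by (rule tendsto_sandwich[OF _ _ tendsto_const lim])
      (simp_all add: eventually_at_filter bd del: inner_scaleR_right real_norm_def)
qed

lemma env_borel_measurable: "env \<in> borel_measurable borel"
proof -
  have "continuous_on UNIV env"
    using GDERIV_env unfolding gderiv_def
    by (auto intro!: continuous_at_imp_continuous_on has_derivative_continuous)
  then show ?thesis by (rule borel_measurable_continuous_onI)
qed

text \<open>Quadratic growth at \<open>z = c\<close> bounds the squared distance from
  \<open>c\<close> to \<open>prox c\<close> by the gap, and the gradient is \<rho> times
  \<open>c - prox c\<close>.\<close>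

lemma norm_grad_env_sq_le:
  "ennreal ((norm (grad env c))\<^sup>2)
    \<le> ennreal (2 * \<rho>\<^sup>2 / (\<rho> - \<rho>bar)) * e2ennreal (\<phi> c - ereal (env c))"
proof (cases "\<phi> c")
  case (real v)
  have "(\<rho> - \<rho>bar) / 2 * (norm (c - prox c))\<^sup>2 \<le> v - env c"
    using quadratic_growth[OF real, of c] by simp
  then have "(norm (c - prox c))\<^sup>2 \<le> 2 / (\<rho> - \<rho>bar) * (v - env c)"
    using less by (simp add: field_simps)
  then have "\<rho>\<^sup>2 * (norm (c - prox c))\<^sup>2 \<le> \<rho>\<^sup>2 * (2 / (\<rho> - \<rho>bar) * (v - env c))"
    by (rule mult_left_mono) simp
  then have "(norm (grad env c))\<^sup>2 \<le> 2 * \<rho>\<^sup>2 / (\<rho> - \<rho>bar) * (v - env c)"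
    unfolding grad_eq[OF GDERIV_env] by (simp add: power_mult_distrib) (simp add: algebra_simps)
  then show ?thesis
    using less by (simp add: real ennreal_mult'[symmetric] ennreal_leI)
next
  case PInf
  \<comment> \<open>Since \<open>0 * top = 0\<close> in \<open>ennreal\<close>, an infinite gap
    makes the right-hand side infinite only for a nonzero constant.\<close>
  have "ennreal (2 * \<rho>\<^sup>2 / (\<rho> - \<rho>bar)) \<noteq> 0" using pos less by simp
  then show ?thesis using PInf by (simp add: ennreal_mult_top del: ennreal_eq_0_iff)
next
  case MInf
  then show ?thesis using lb[of c] by simp
qed

end

section \<open>Expected descent along the iterates\<close>

lemma subalgebra_history:
  assumes "\<And>i. i \<ge> 1 \<Longrightarrow> x i \<in> borel_measurable M"
  shows "subalgebra M (history M x k)"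
proof -
  let ?G = "{x i -` A \<inter> space M | i A. i \<in> {1..<k} \<and> A \<in> sets borel}"
  have "?G \<subseteq> sets M" using assms by (auto intro: measurable_sets)
  then show ?thesis
    unfolding subalgebra_def history_def
    by (auto simp: space_measure_of_conv sets_measure_of_conv
        intro: sets.sigma_sets_subset[THEN subsetD])
qed

context prox_problem
begin

text \<open>The current excess over \<open>m\<close> splits into the gap \<open>D\<close> above the
  envelope and the rest \<open>E\<close>. The next excess is at most \<open>H + E\<close>, and the
  inexactness condition bounds the mean of \<open>H\<close> by \<open>lam\<close> times that of
  \<open>D\<close> plus the error.\<close>

lemma sipp_step:
  assumes M: "prob_space M" and sipp: "sipp_sequence M \<phi> \<rho> lam \<zeta> x0 x"
    and lam: "0 \<le> lam" "lam \<le> 1"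
  shows "(\<integral>\<^sup>+\<omega>. e2ennreal (\<phi> (x (Suc k) \<omega>) - ereal m) \<partial>M)
      + ennreal (1 - lam) * (\<integral>\<^sup>+\<omega>. e2ennreal (\<phi> (x k \<omega>) - ereal (env (x k \<omega>))) \<partial>M)
    \<le> (\<integral>\<^sup>+\<omega>. e2ennreal (\<phi> (x k \<omega>) - ereal m) \<partial>M) + (\<integral>\<^sup>+\<omega>. ennreal (\<zeta> (Suc k) \<omega>) \<partial>M)"
proof -
  interpret M: prob_space M by (rule M)
  have x0: "\<forall>\<omega>\<in>space M. x 0 \<omega> = x0"
    and xS: "\<And>i. i \<ge> 1 \<Longrightarrow> x i \<in> borel_measurable M"
    and \<zeta>H: "\<zeta> (Suc k) \<in> borel_measurable (history M x (Suc k))"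
    and \<zeta>0: "\<And>\<omega>. \<omega> \<in> space M \<Longrightarrow> 0 \<le> \<zeta> (Suc k) \<omega>"
    using sipp unfolding sipp_sequence_def by auto
  define H where "H \<omega> = e2ennreal (prox_objective \<phi> \<rho> (x k \<omega>) (x (Suc k) \<omega>)
      - ereal (env (x k \<omega>)))" for \<omega>
  define D where "D \<omega> = e2ennreal (\<phi> (x k \<omega>) - ereal (env (x k \<omega>)))" for \<omega>
  define E where "E \<omega> = ennreal (env (x k \<omega>) - m)" for \<omega>
  have ae: "AE \<omega> in M. enn2ereal (nn_cond_exp M (history M x (Suc k)) H \<omega>)
      \<le> ereal lam * (\<phi> (x k \<omega>) - ereal (env (x k \<omega>))) + ereal (\<zeta> (Suc k) \<omega>)"
  proof -
    \<comment> \<open>At its own centre the proximal term vanishes, and the minimal value is the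
      envelope; this turns the inexactness condition into one about the gap.\<close>
    have "prox_objective \<phi> \<rho> c c = \<phi> c" for c unfolding prox_objective_def by simp
    then show ?thesis
      using sipp unfolding sipp_sequence_def Let_def H_def by (auto simp: env_eq dest!: spec[of _ "Suc k"])
  qed
  \<comment> \<open>The definition of the method gives measurability from index 1 on;
    \<open>x 0\<close> is constant on the space.\<close>
  have x_meas[measurable]: "x i \<in> borel_measurable M" for i
  proof (cases i)
    case 0
    have "(\<lambda>_. x0) \<in> borel_measurable M" by simp
    then show ?thesis using x0 0 by (subst measurable_cong[of M _ "\<lambda>_. x0"]) auto
  qed (use xS in simp)
  interpret S: finite_measure_subalgebra M "history M x (Suc k)"
    by unfold_locales (rule subalgebra_history[OF xS])
  have [measurable]: "\<zeta> (Suc k) \<in> borel_measurable M"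
    by (rule measurable_from_subalg[OF S.subalg \<zeta>H])
  note lower_semicontinuous_borel_measurable[OF lsc, measurable]
    env_borel_measurable[measurable]
  note measurable_e2ennreal[measurable]
  have H_meas[measurable]: "H \<in> borel_measurable M"
    unfolding H_def prox_objective_def by measurable
  have D_meas[measurable]: "D \<in> borel_measurable M" unfolding D_def by measurable
  have E_meas[measurable]: "E \<in> borel_measurable M" unfolding E_def by measurable
  have split: "e2ennreal (\<phi> (x k \<omega>) - ereal m) = D \<omega> + E \<omega>" for \<omega>
    using env_le[of "x k \<omega>"] lb_env[of "x k \<omega>"] unfolding D_def E_def
    by (cases "\<phi> (x k \<omega>)") (auto simp: ennreal_plus[symmetric] simp del: ennreal_plus)
  \<comment> \<open>The envelope value cancels in \<open>H + E\<close>, leaving the proximal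
    objective minus \<open>m\<close>; its quadratic term is then dropped.\<close>
  have next_le: "e2ennreal (\<phi> (x (Suc k) \<omega>) - ereal m) \<le> H \<omega> + E \<omega>" for \<omega>
  proof (cases "\<phi> (x (Suc k) \<omega>)")
    case (real v)
    define q where "q = \<rho> / 2 * (norm (x (Suc k) \<omega> - x k \<omega>))\<^sup>2"
    have q: "0 \<le> q" using pos unfolding q_def by simp
    have obj: "prox_objective \<phi> \<rho> (x k \<omega>) (x (Suc k) \<omega>) = ereal (v + q)"
      unfolding prox_objective_def real q_def by simp
    have "env (x k \<omega>) \<le> v + q"
      using env_le_prox_objective[of "x k \<omega>" "x (Suc k) \<omega>"] unfolding obj by simp
    then have "H \<omega> + E \<omega> = ennreal (v + q - m)"
      using lb_env[of "x k \<omega>"] unfolding H_def E_def obj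
      by (simp add: ennreal_plus[symmetric] del: ennreal_plus)
    then show ?thesis using q real by (simp add: ennreal_leI)
  next
    case PInf
    then show ?thesis unfolding H_def prox_objective_def by simp
  next
    case MInf
    then show ?thesis using lb[of "x (Suc k) \<omega>"] by simp
  qed
  \<comment> \<open>Tower property: the defining identity of the conditional expectation, tested
    with the constant 1.\<close>
  have "(\<integral>\<^sup>+\<omega>. H \<omega> \<partial>M) = (\<integral>\<^sup>+\<omega>. nn_cond_exp M (history M x (Suc k)) H \<omega> \<partial>M)"
    using S.nn_cond_exp_intg[of "\<lambda>_. 1" H] by simp
  also have "\<dots> \<le> (\<integral>\<^sup>+\<omega>. ennreal lam * D \<omega> + ennreal (\<zeta> (Suc k) \<omega>) \<partial>M)"
  proof (rule nn_integral_mono_AE, use ae AE_space in eventually_elim)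
    case (elim \<omega>)
    \<comment> \<open>Nonnegativity of the gap ensures that \<open>e2ennreal\<close> does not
      truncate it.\<close>
    have "0 \<le> \<phi> (x k \<omega>) - ereal (env (x k \<omega>))"
      using env_le[of "x k \<omega>"] by (cases "\<phi> (x k \<omega>)") auto
    then have "enn2ereal (ennreal lam * D \<omega> + ennreal (\<zeta> (Suc k) \<omega>))
        = ereal lam * (\<phi> (x k \<omega>) - ereal (env (x k \<omega>))) + ereal (\<zeta> (Suc k) \<omega>)"
      using \<zeta>0 elim(2) lam unfolding D_def
      by (simp add: plus_ennreal.rep_eq times_ennreal.rep_eq enn2ereal_e2ennreal)
    then show ?case using elim(1) by (simp add: less_eq_ennreal.rep_eq)
  qed
  also have "\<dots> = ennreal lam * (\<integral>\<^sup>+\<omega>. D \<omega> \<partial>M) + (\<integral>\<^sup>+\<omega>. ennreal (\<zeta> (Suc k) \<omega>) \<partial>M)"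
    by (simp add: nn_integral_add nn_integral_cmult)
  finally have H_le: "(\<integral>\<^sup>+\<omega>. H \<omega> \<partial>M)
      \<le> ennreal lam * (\<integral>\<^sup>+\<omega>. D \<omega> \<partial>M) + (\<integral>\<^sup>+\<omega>. ennreal (\<zeta> (Suc k) \<omega>) \<partial>M)" .
  \<comment> \<open>Adding \<open>1 - lam\<close> times the mean of \<open>D\<close> to the bound
    restores weight 1 on it, so that \<open>D + E\<close> is again the current excess.\<close>
  have lam1: "ennreal lam + ennreal (1 - lam) = 1"
    using lam by (simp add: ennreal_plus[symmetric] del: ennreal_plus)
  have "(\<integral>\<^sup>+\<omega>. e2ennreal (\<phi> (x (Suc k) \<omega>) - ereal m) \<partial>M) \<le> (\<integral>\<^sup>+\<omega>. H \<omega> + E \<omega> \<partial>M)"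
    by (rule nn_integral_mono) (rule next_le)
  also have "\<dots> = (\<integral>\<^sup>+\<omega>. H \<omega> \<partial>M) + (\<integral>\<^sup>+\<omega>. E \<omega> \<partial>M)"
    by (rule nn_integral_add) measurable
  also note H_le
  finally have "(\<integral>\<^sup>+\<omega>. e2ennreal (\<phi> (x (Suc k) \<omega>) - ereal m) \<partial>M)
      + ennreal (1 - lam) * (\<integral>\<^sup>+\<omega>. D \<omega> \<partial>M)
    \<le> (ennreal lam + ennreal (1 - lam)) * (\<integral>\<^sup>+\<omega>. D \<omega> \<partial>M) + (\<integral>\<^sup>+\<omega>. E \<omega> \<partial>M)
      + (\<integral>\<^sup>+\<omega>. ennreal (\<zeta> (Suc k) \<omega>) \<partial>M)"
    by (simp add: distrib_right add_ac add_right_mono)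
  also have "(ennreal lam + ennreal (1 - lam)) * (\<integral>\<^sup>+\<omega>. D \<omega> \<partial>M) + (\<integral>\<^sup>+\<omega>. E \<omega> \<partial>M)
      = (\<integral>\<^sup>+\<omega>. e2ennreal (\<phi> (x k \<omega>) - ereal m) \<partial>M)"
    unfolding lam1 split by (simp add: nn_integral_add)
  finally show ?thesis unfolding D_def .
qed

text \<open>The step from \<open>k\<close> to \<open>Suc k\<close> pairs the gap at \<open>k\<close>
  with the error at \<open>Suc k\<close>, hence gaps 0 to \<open>K - 1\<close> against errors 1 to
  \<open>K\<close>.\<close>

lemma sipp_telescoped:
  assumes "prob_space M" "sipp_sequence M \<phi> \<rho> lam \<zeta> x0 x" "0 \<le> lam" "lam \<le> 1"
  shows "(\<integral>\<^sup>+\<omega>. e2ennreal (\<phi> (x K \<omega>) - ereal m) \<partial>M)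
      + ennreal (1 - lam) * (\<Sum>k<K. \<integral>\<^sup>+\<omega>. e2ennreal (\<phi> (x k \<omega>) - ereal (env (x k \<omega>))) \<partial>M)
    \<le> e2ennreal (\<phi> x0 - ereal m) + (\<Sum>k=1..K. \<integral>\<^sup>+\<omega>. ennreal (\<zeta> k \<omega>) \<partial>M)"
proof (induction K)
  case 0
  interpret M: prob_space M by fact
  have "x 0 \<omega> = x0" if "\<omega> \<in> space M" for \<omega>
    using assms(2) that unfolding sipp_sequence_def by blast
  then have "(\<integral>\<^sup>+\<omega>. e2ennreal (\<phi> (x 0 \<omega>) - ereal m) \<partial>M)
      = (\<integral>\<^sup>+\<omega>. e2ennreal (\<phi> x0 - ereal m) \<partial>M)"
    by (intro nn_integral_cong) simp
  then show ?case by (simp add: M.emeasure_space_1)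
next
  case (Suc K)
  let ?A = "\<lambda>k. \<integral>\<^sup>+\<omega>. e2ennreal (\<phi> (x k \<omega>) - ereal m) \<partial>M"
  let ?D = "\<lambda>k. \<integral>\<^sup>+\<omega>. e2ennreal (\<phi> (x k \<omega>) - ereal (env (x k \<omega>))) \<partial>M"
  have "?A (Suc K) + ennreal (1 - lam) * (\<Sum>k<Suc K. ?D k)
      = (?A (Suc K) + ennreal (1 - lam) * ?D K) + ennreal (1 - lam) * (\<Sum>k<K. ?D k)"
    by (simp add: distrib_left add_ac)
  also have "\<dots> \<le> (?A K + (\<integral>\<^sup>+\<omega>. ennreal (\<zeta> (Suc K) \<omega>) \<partial>M)) + ennreal (1 - lam) * (\<Sum>k<K. ?D k)"
    by (rule add_right_mono) (rule sipp_step[OF assms])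
  also have "\<dots> = (?A K + ennreal (1 - lam) * (\<Sum>k<K. ?D k)) + (\<integral>\<^sup>+\<omega>. ennreal (\<zeta> (Suc K) \<omega>) \<partial>M)"
    by (simp add: add_ac)
  also have "\<dots> \<le> (e2ennreal (\<phi> x0 - ereal m) + (\<Sum>k=1..K. \<integral>\<^sup>+\<omega>. ennreal (\<zeta> k \<omega>) \<partial>M))
      + (\<integral>\<^sup>+\<omega>. ennreal (\<zeta> (Suc K) \<omega>) \<partial>M)"
    by (rule add_right_mono) (rule Suc.IH)
  finally show ?case by (simp add: add_ac)
qed

lemma sipp_sum_grad_le:
  assumes "prob_space M" "sipp_sequence M \<phi> \<rho> lam \<zeta> x0 x" "0 \<le> lam" "lam \<le> 1"
  shows "ennreal (1 - lam) * (\<Sum>k=1..K. \<integral>\<^sup>+\<omega>. ennreal ((norm (grad env (x k \<omega>)))\<^sup>2) \<partial>M)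
    \<le> ennreal (2 * \<rho>\<^sup>2 / (\<rho> - \<rho>bar))
      * (e2ennreal (\<phi> x0 - ereal m) + (\<Sum>k=1..K. \<integral>\<^sup>+\<omega>. ennreal (\<zeta> k \<omega>) \<partial>M))"
proof -
  let ?C = "ennreal (2 * \<rho>\<^sup>2 / (\<rho> - \<rho>bar))"
  let ?D = "\<lambda>k. \<integral>\<^sup>+\<omega>. e2ennreal (\<phi> (x k \<omega>) - ereal (env (x k \<omega>))) \<partial>M"
  have x_meas: "x k \<in> borel_measurable M" if "k \<ge> 1" for k
    using assms(2) that unfolding sipp_sequence_def by blast
  note lower_semicontinuous_borel_measurable[OF lsc, measurable]
    env_borel_measurable[measurable]
  note measurable_e2ennreal[measurable]
  have D: "(\<integral>\<^sup>+\<omega>. ennreal ((norm (grad env (x k \<omega>)))\<^sup>2) \<partial>M) \<le> ?C * ?D k" if "k \<ge> 1" for k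
  proof -
    note x_meas[OF that, measurable]
    have "(\<integral>\<^sup>+\<omega>. ennreal ((norm (grad env (x k \<omega>)))\<^sup>2) \<partial>M)
        \<le> (\<integral>\<^sup>+\<omega>. ?C * e2ennreal (\<phi> (x k \<omega>) - ereal (env (x k \<omega>))) \<partial>M)"
      by (intro nn_integral_mono norm_grad_env_sq_le)
    also have "\<dots> = ?C * ?D k" by (rule nn_integral_cmult) measurable
    finally show ?thesis .
  qed
  \<comment> \<open>the last summand involves no further step of the method: the gap at \<open>x K\<close> is bounded by
    \<open>\<phi> (x K) - m\<close>, which is what the telescoping leaves over\<close>
  have last: "?D K \<le> (\<integral>\<^sup>+\<omega>. e2ennreal (\<phi> (x K \<omega>) - ereal m) \<partial>M)"
    using lb_env by (intro nn_integral_mono e2ennreal_mono ereal_minus_mono) auto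
  \<comment> \<open>The nonnegative gap at index 0 is added so that, once the gap at
    \<open>K\<close> is split off, the range matches the telescoped bound.\<close>
  have "ennreal (1 - lam) * (\<Sum>k=1..K. ?D k) \<le> ennreal (1 - lam) * (\<Sum>k<Suc K. ?D k)"
    by (intro mult_left_mono sum_mono2) auto
  also have "\<dots> = ennreal (1 - lam) * ?D K + ennreal (1 - lam) * (\<Sum>k<K. ?D k)"
    by (simp add: distrib_left add_ac)
  also have "ennreal (1 - lam) * ?D K \<le> 1 * ?D K"
    using assms(3) by (intro mult_right_mono) (simp_all add: ennreal_le_1)
  also have "1 * ?D K \<le> (\<integral>\<^sup>+\<omega>. e2ennreal (\<phi> (x K \<omega>) - ereal m) \<partial>M)" using last by simp
  also note sipp_telescoped[OF assms]
  finally have tel: "ennreal (1 - lam) * (\<Sum>k=1..K. ?D k)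
      \<le> e2ennreal (\<phi> x0 - ereal m) + (\<Sum>k=1..K. \<integral>\<^sup>+\<omega>. ennreal (\<zeta> k \<omega>) \<partial>M)"
    by (simp add: add_right_mono)
  have "ennreal (1 - lam) * (\<Sum>k=1..K. \<integral>\<^sup>+\<omega>. ennreal ((norm (grad env (x k \<omega>)))\<^sup>2) \<partial>M)
      \<le> ennreal (1 - lam) * (\<Sum>k=1..K. ?C * ?D k)"
    by (intro mult_left_mono sum_mono D) auto
  also have "\<dots> = ?C * (ennreal (1 - lam) * (\<Sum>k=1..K. ?D k))"
    by (simp add: sum_distrib_left[symmetric] mult_ac)
  also have "\<dots> \<le> ?C * (e2ennreal (\<phi> x0 - ereal m) + (\<Sum>k=1..K. \<integral>\<^sup>+\<omega>. ennreal (\<zeta> k \<omega>) \<partial>M))"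
    by (intro mult_left_mono tel) simp
  finally show ?thesis .
qed

end

section \<open>Composite objective and final estimate\<close>

lemma enn2ereal_le_times_divide:
  assumes le: "ennreal N * g \<le> ennreal C * (ennreal a + s)" and pos: "0 < N" "0 < C" "0 \<le> a"
  shows "enn2ereal g \<le> ereal C * ((ereal a + enn2ereal s) / ereal N)"
proof (cases s)
  case top
  then show ?thesis using pos by (simp add: ereal_mult_infty)
next
  case (real s')
  have fin: "ennreal N * g \<le> ennreal (C * (a + s'))"
    using le pos real by (simp add: ennreal_mult)
  then obtain g' where g': "g = ennreal g'" "0 \<le> g'"
    using pos by (cases g) (auto simp: ennreal_mult_top top_unique)
  have "ennreal (N * g') \<le> ennreal (C * (a + s'))"
    using fin g' pos by (simp add: ennreal_mult)
  then have "N * g' \<le> C * (a + s')"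
    using pos real by (subst (asm) ennreal_le_iff) auto
  then have "g' \<le> C * ((a + s') / N)"
    using pos by (simp add: pos_le_divide_eq mult.commute)
  then show ?thesis using real g' pos by simp
qed

text \<open>The lower bound \<open>m\<close> is the minimum itself, finite because \<open>r\<close>
  is proper. The quadratic is grouped with \<open>h\<close>, where weak convexity makes the sum
  convex.\<close>

lemma prox_problem_composite:
  assumes r: "\<And>y. r y \<noteq> -\<infinity>" "effective_domain r \<noteq> {}" "convex_ereal r" "lower_semicontinuous r"
    and h: "continuous_on UNIV h" "weakly_convex \<rho>bar h"
    and z: "is_arg_min (composite h r) (\<lambda>_. True) z" and \<rho>: "0 < \<rho>bar" "\<rho>bar < \<rho>"
  obtains m where "composite h r z = ereal m" "prox_problem (composite h r) \<rho>bar \<rho> m"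
proof -
  have min: "composite h r z \<le> composite h r y" for y
    using z by (auto simp: is_arg_min_def not_less)
  obtain y0 where y0: "r y0 < \<infinity>" using r(2) unfolding effective_domain_def by auto
  then have fin: "composite h r y0 < \<infinity>" unfolding composite_def by auto
  then obtain m where m: "composite h r z = ereal m"
    using min[of y0] r(1)[of z] unfolding composite_def by (cases "r z") auto
  have "prox_problem (composite h r) \<rho>bar \<rho> m"
  proof
    show "convex_ereal (\<lambda>z. composite h r z + ereal (\<rho>bar / 2 * (norm z)\<^sup>2))"
      unfolding convex_ereal_def
    proof (intro allI ballI)
      fix u v :: 'a and t :: real assume t: "t \<in> {0..1}"
      let ?g = "\<lambda>z. h z + \<rho>bar / 2 * (norm z)\<^sup>2"
      have split: "composite h r z + ereal (\<rho>bar / 2 * (norm z)\<^sup>2) = r z + ereal (?g z)" for z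
        unfolding composite_def by (cases "r z") auto
      have g: "?g (t *\<^sub>R u + (1 - t) *\<^sub>R v) \<le> t * ?g u + (1 - t) * ?g v"
        using h(2) t unfolding weakly_convex_def convex_on_def by auto
      have "r (t *\<^sub>R u + (1 - t) *\<^sub>R v) + ereal (?g (t *\<^sub>R u + (1 - t) *\<^sub>R v))
          \<le> (ereal t * r u + ereal (1 - t) * r v) + ereal (t * ?g u + (1 - t) * ?g v)"
        using r(3) t g unfolding convex_ereal_def by (intro add_mono) auto
      \<comment> \<open>The endpoints of \<open>t\<close> are separate cases because
        \<open>0 * \<infinity> = 0\<close> in \<open>ereal\<close>.\<close>
      also have "\<dots> = ereal t * (r u + ereal (?g u)) + ereal (1 - t) * (r v + ereal (?g v))"
        using t r(1)[of u] r(1)[of v]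
        by (cases "r u"; cases "r v"; cases "t = 0"; cases "t = 1") (auto simp: algebra_simps)
      finally show "composite h r (t *\<^sub>R u + (1 - t) *\<^sub>R v)
            + ereal (\<rho>bar / 2 * (norm (t *\<^sub>R u + (1 - t) *\<^sub>R v))\<^sup>2)
          \<le> ereal t * (composite h r u + ereal (\<rho>bar / 2 * (norm u)\<^sup>2))
            + ereal (1 - t) * (composite h r v + ereal (\<rho>bar / 2 * (norm v)\<^sup>2))"
        unfolding split .
    qed
    have "composite h r = (\<lambda>z. r z + ereal (h z))"
      unfolding composite_def by (simp add: fun_eq_iff add.commute)
    then show "lower_semicontinuous (composite h r)"
      using lower_semicontinuous_add_continuous[OF r(4) h(1)] by simp
  qed (use min m fin \<rho> in auto)
  with m show ?thesis by (rule that)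
qed

theorem theorem5p3:
  fixes P :: "'s measure"
    and F :: "'a::euclidean_space \<Rightarrow> 's \<Rightarrow> real"
    and f :: "'a \<Rightarrow> real"
    and Fs :: "real \<Rightarrow> 'a \<Rightarrow> 's \<Rightarrow> real"
    and fs :: "real \<Rightarrow> 'a \<Rightarrow> real"
    and r :: "'a \<Rightarrow> ereal"
    and X :: "'a set"
    and \<theta> \<rho>bar R B L \<sigma> \<eta> \<rho>hat lam :: real
    and M :: "'w measure"
    and x0 xstar :: 'a
    and x :: "nat \<Rightarrow> 'w \<Rightarrow> 'a"
    and \<zeta> :: "nat \<Rightarrow> 'w \<Rightarrow> real"
    and K :: nat
  \<comment> \<open>the original problem\<close>
  assumes "prob_space P"
    and "\<And>y. integrable P (F y)"
    and "\<And>y. f y = (\<integral>\<xi>. F y \<xi> \<partial>P)"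
    and "\<And>\<xi>. \<xi> \<in> space P \<Longrightarrow> \<exists>\<rho>\<ge>0. weakly_convex \<rho> (\<lambda>y. F y \<xi>)"
    and "\<And>y. r y \<noteq> -\<infinity>"
    and "effective_domain r \<noteq> {}"
    and "convex_ereal r"
    and "lower_semicontinuous r"
    and "\<exists>b::real. \<forall>y. ereal b \<le> r y"
    and "effective_domain r \<subseteq> X" "closed X" "convex X"
  \<comment> \<open>the smoothed problem\<close>
    and "\<theta> > 0" "\<rho>bar > 0" "R \<ge> 0" "B \<ge> 0" "L \<ge> 0"
    and "\<And>e y. e \<in> {0<..\<theta>} \<Longrightarrow> integrable P (Fs e y)"
    and "\<And>e y. e \<in> {0<..\<theta>} \<Longrightarrow> fs e y = (\<integral>\<xi>. Fs e y \<xi> \<partial>P)"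
    and "\<And>e y. e \<in> {0<..\<theta>} \<Longrightarrow> fs e differentiable (at y)"
    and "\<And>e. e \<in> {0<..\<theta>} \<Longrightarrow> continuous_on UNIV (grad (fs e))"
    and "\<And>e. e \<in> {0<..\<theta>} \<Longrightarrow> weakly_convex \<rho>bar (fs e)"
    and "\<And>e y. e \<in> {0<..\<theta>} \<Longrightarrow> y \<in> X \<Longrightarrow> fs e y \<le> f y \<and> f y \<le> fs e y + R * e"
    and "\<And>e y z. e \<in> {0<..\<theta>} \<Longrightarrow> y \<in> X \<Longrightarrow> z \<in> X \<Longrightarrow>
           norm (grad (fs e) y - grad (fs e) z) \<le> (B + L / e) * norm (y - z)"
  \<comment> \<open>the stochastic gradients\<close>
    and "\<And>e y \<xi>. e \<in> {0<..\<theta>} \<Longrightarrow> y \<in> effective_domain r \<Longrightarrow> \<xi> \<in> space P \<Longrightarrow>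
           (\<lambda>z. Fs e z \<xi>) differentiable (at y)"
    and "\<And>e y. e \<in> {0<..\<theta>} \<Longrightarrow> y \<in> effective_domain r \<Longrightarrow>
           integrable P (\<lambda>\<xi>. grad (\<lambda>z. Fs e z \<xi>) y)"
    and "\<And>e y. e \<in> {0<..\<theta>} \<Longrightarrow> y \<in> effective_domain r \<Longrightarrow>
           grad (fs e) y = (\<integral>\<xi>. grad (\<lambda>z. Fs e z \<xi>) y \<partial>P)"
    and "\<And>e y. e \<in> {0<..\<theta>} \<Longrightarrow> y \<in> effective_domain r \<Longrightarrow>
           (\<integral>\<^sup>+\<xi>. ennreal ((norm (grad (\<lambda>z. Fs e z \<xi>) y - grad (fs e) y))\<^sup>2) \<partial>P)
             \<le> ennreal (\<sigma>\<^sup>2)"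
  \<comment> \<open>the fixed smoothing parameter and the minimizers\<close>
    and "\<eta> \<in> {0<..\<theta>}"
    and "\<exists>z. is_arg_min (composite (fs \<eta>) r) (\<lambda>_. True) z"
    and "is_arg_min (composite f r) (\<lambda>_. True) xstar"
  \<comment> \<open>the algorithm\<close>
    and "\<rho>hat > \<rho>bar"
    and "lam \<in> {0..<1}"
    and "x0 \<in> effective_domain r"
    and "prob_space M"
    and "sipp_sequence M (composite (fs \<eta>) r) \<rho>hat lam \<zeta> x0 x"
    and "K \<ge> 1"
  shows "enn2ereal (MIN k\<in>{1..K}.
           \<integral>\<^sup>+\<omega>. ennreal ((norm (grad (moreau_envelope (composite (fs \<eta>) r) \<rho>hat) (x k \<omega>)))\<^sup>2) \<partial>M)
         \<le> ereal (2 * \<rho>hat\<^sup>2 / (\<rho>hat - \<rho>bar)) *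
           ((ereal (1 + lam) * (composite f r x0 - composite f r xstar + ereal (R * \<eta>))
              + enn2ereal (\<Sum>k=1..K. \<integral>\<^sup>+\<omega>. ennreal (\<zeta> k \<omega>) \<partial>M))
            / ereal ((1 - lam) * real K))"
proof -
  note r_ninf = assms(5) and r_dom = assms(6) and r_conv = assms(7) and r_lsc = assms(8)
    and dom_X = assms(10) and fs_diff = assms(20) and fs_wconv = assms(22) and approx = assms(23)
    and \<eta> = assms(29) and \<rho>hat = assms(32) and lam = assms(33) and x0_dom = assms(34)
  let ?\<phi> = "composite (fs \<eta>) r"
  obtain z where z: "is_arg_min ?\<phi> (\<lambda>_. True) z" using assms(30) by blast
  have "continuous_on UNIV (fs \<eta>)"
    using fs_diff[OF \<eta>] by (auto intro!: continuous_at_imp_continuous_on differentiable_imp_continuous_within)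
  then obtain m where m: "?\<phi> z = ereal m" and "prox_problem ?\<phi> \<rho>bar \<rho>hat m"
    using prox_problem_composite[OF r_ninf r_dom r_conv r_lsc _ fs_wconv[OF \<eta>] z \<open>\<rho>bar > 0\<close> \<rho>hat]
    by blast
  then interpret prox_problem ?\<phi> \<rho>bar \<rho>hat m by simp
  have min_f: "composite f r xstar \<le> composite f r y" for y
    using assms(31) by (auto simp: is_arg_min_def not_less)
  obtain r0 where r0: "r x0 = ereal r0"
    using x0_dom r_ninf[of x0] unfolding effective_domain_def by (cases "r x0") auto
  obtain rz where rz: "r z = ereal rz"
    using m unfolding composite_def by (cases "r z") auto
  obtain rs where rs: "r xstar = ereal rs"
    using min_f[of x0] r0 r_ninf[of xstar] unfolding composite_def by (cases "r xstar") auto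
  define A where "A = f x0 + r0 - (f xstar + rs) + R * \<eta>"
  have "x0 \<in> X" "z \<in> X"
    using x0_dom dom_X rz unfolding effective_domain_def by auto
  \<comment> \<open>Smoothing lowers the value at \<open>x0\<close>, and the optimal value of the
    original problem is at most its value at \<open>z\<close>, hence at most
    \<open>m + R * \<eta>\<close>.\<close>
  then have "fs \<eta> x0 + r0 - m \<le> A"
    using approx[OF \<eta>, of x0] approx[OF \<eta>, of z] min_f[of z] m
    unfolding A_def composite_def rz rs by simp
  moreover have "0 \<le> A"
    using min_f[of x0] \<open>R \<ge> 0\<close> \<eta> unfolding A_def composite_def r0 rs by simp
  \<comment> \<open>The descent estimate yields the factor 1 on \<open>A\<close>; it is enlarged
    here to the stated one.\<close>
  then have "A \<le> (1 + lam) * A" using lam by (simp add: distrib_right)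
  ultimately have start: "e2ennreal (?\<phi> x0 - ereal m) \<le> ennreal ((1 + lam) * A)"
    unfolding composite_def r0 by (simp add: ennreal_leI)
  let ?G = "\<lambda>k. \<integral>\<^sup>+\<omega>. ennreal ((norm (grad (moreau_envelope ?\<phi> \<rho>hat) (x k \<omega>)))\<^sup>2) \<partial>M"
  let ?Z = "\<Sum>k=1..K. \<integral>\<^sup>+\<omega>. ennreal (\<zeta> k \<omega>) \<partial>M"
  let ?C = "2 * \<rho>hat\<^sup>2 / (\<rho>hat - \<rho>bar)"
  let ?N = "(1 - lam) * real K"
  have C: "0 < ?C" using pos \<rho>hat by simp
  have N: "0 < ?N" using lam \<open>K \<ge> 1\<close> by simp
  \<comment> \<open>\<open>K\<close> copies of the minimum are compared with the sum term by
    term.\<close>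
  have "ennreal ?N * (MIN k\<in>{1..K}. ?G k) = ennreal (1 - lam) * (\<Sum>k=1..K. MIN k\<in>{1..K}. ?G k)"
    using lam by (simp add: ennreal_mult ennreal_of_nat_eq_real_of_nat mult.assoc)
  also have "\<dots> \<le> ennreal (1 - lam) * (\<Sum>k=1..K. ?G k)"
    by (intro mult_left_mono sum_mono Min_le) auto
  also have "\<dots> \<le> ennreal ?C * (e2ennreal (?\<phi> x0 - ereal m) + ?Z)"
    using lam by (intro sipp_sum_grad_le assms) auto
  also have "\<dots> \<le> ennreal ?C * (ennreal ((1 + lam) * A) + ?Z)"
    by (intro mult_left_mono add_right_mono start) simp
  finally have main: "ennreal ?N * (MIN k\<in>{1..K}. ?G k) \<le> ennreal ?C * (ennreal ((1 + lam) * A) + ?Z)" .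
  have A: "composite f r x0 - composite f r xstar + ereal (R * \<eta>) = ereal A"
    unfolding composite_def r0 rs A_def by simp
  have "0 \<le> (1 + lam) * A" using \<open>0 \<le> A\<close> lam by simp
  from enn2ereal_le_times_divide[OF main N C this]
  show ?thesis unfolding A times_ereal.simps(1) .
qed

end
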